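(* Let $op$ be an $n$-ary $T$-algebraic operation and let $B$ be a binary relation on $R$. If the induced function $op_R:R^n\to R$ distributes over $B$, then $\widetilde{op}$ distributes over $op_B$.
   Context: $T$ is a monad on the category of sets with unit $\eta_T$ and Kleisli extension $(-)^{\dagger_T}$, and $R$ is a set carrying a $T$-algebra structure $\alpha_T:T(R)\to R$. Put $S_T(X)=(X\to R)\to T(X)$ (the augmented selection monad). For $F\in S_T(X)$ and $\gamma:X\to R$ put $\mathbf R(F|\gamma)=\alpha_T(T(\gamma)(F(\gamma)))\in R$. An $n$-ary $T$-algebraic operation $op$ is a family of functions $op_X:T(X)^n\to T(X)$ ($X$ a set) such that $e^{\dagger_T}(op_X(u_0,\dots,u_{n-1}))=op_Y(e^{\dagger_T}(u_0),\dots,e^{\dagger_T}(u_{n-1}))$ for all $e:X\to T(Y)$ and $u_j\in T(X)$. It induces a function on $R$, here denoted $op_R:R^n\to R$, by sending $(r_0,\dots,r_{n-1})$ to $\alpha_T$ applied to the result of the component of $op$ at the set $R$ on $(\eta_T(r_0),\dots,\eta_T(r_{n-1}))$. It also yields an $n$-ary operation $\widetilde{op}$ on $S_T$ defined pointwise: $\widetilde{op}_X(F_0,\dots,F_{n-1})(\gamma)=op_X(F_0(\gamma),\dots,F_{n-1}(\gamma))$. For a binary relation $B$ on $R$, $op_B$ is the family of binary operations on the sets $S_T(X)$ with $(op_B)_X(G_0,G_1)(\gamma)=G_0(\gamma)$ if $\mathbf R(G_0|\gamma)\,B\,\mathbf R(G_1|\gamma)$, and $=G_1(\gamma)$ otherwise.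 A function $f:R^n\to R$ distributes over $B$ if for every position $i$ and all $r_j\in R$ ($j\ne i$) and $s_0,s_1\in R$: $s_0\,B\,s_1$ iff $f(r_0,\dots,r_{i-1},s_0,r_{i+1},\dots,r_{n-1})\;B\;f(r_0,\dots,r_{i-1},s_1,r_{i+1},\dots,r_{n-1})$. $\widetilde{op}$ distributes over $op_B$ if for every set $X$, position $i$, all $F_j\in S_T(X)$ ($j\neq i$) and $G_0,G_1\in S_T(X)$: $\widetilde{op}_X(F_0,\dots,F_{i-1},op_B(G_0,G_1),F_{i+1},\dots,F_{n-1})=op_B\big(\widetilde{op}_X(F_0,\dots,F_{i-1},G_0,F_{i+1},\dots,F_{n-1}),\ \widetilde{op}_X(F_0,\dots,F_{i-1},G_1,F_{i+1},\dots,F_{n-1})\big)$. *)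

theory Defs
  imports "HOL-Library.FuncSet"
begin

text \<open>
  The category of sets is represented by a collection \<open>Obj\<close> of sets over a type \<open>'u\<close>; its
  morphisms from \<open>X\<close> to \<open>Y\<close> are all the functions in \<open>X \<rightarrow>\<^sub>E Y\<close>.  No closure
  condition is imposed on \<open>Obj\<close>: taking for it the sets of a universe gives the category of
  sets itself.  Extensionality (\<open>\<rightarrow>\<^sub>E\<close>) makes equality in HOL coincide with equality of
  morphisms.
\<close>

record 'u kleisli_triple =
  Obj :: "'u set set"
  T :: "'u set \<Rightarrow> 'u set"
  eta :: "'u set \<Rightarrow> 'u \<Rightarrow> 'u"
  kleisli :: "'u set \<Rightarrow> 'u set \<Rightarrow> ('u \<Rightarrow> 'u) \<Rightarrow> 'u \<Rightarrow> 'u"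
    \<comment> \<open>\<open>kleisli M X Y e\<close> is the extension \<open>T X \<rightarrow> T Y\<close> of \<open>e : X \<rightarrow> T Y\<close>\<close>

definition set_monad :: "'u kleisli_triple \<Rightarrow> bool" where
  "set_monad M \<longleftrightarrow>
    (\<forall>X\<in>Obj M. T M X \<in> Obj M) \<and>
    (\<forall>X\<in>Obj M. eta M X \<in> X \<rightarrow>\<^sub>E T M X) \<and>
    (\<forall>X\<in>Obj M. \<forall>Y\<in>Obj M. \<forall>e \<in> X \<rightarrow>\<^sub>E T M Y. kleisli M X Y e \<in> T M X \<rightarrow>\<^sub>E T M Y) \<and>
    (\<forall>X\<in>Obj M. kleisli M X X (eta M X) = (\<lambda>u\<in>T M X. u)) \<and>
    (\<forall>X\<in>Obj M. \<forall>Y\<in>Obj M. \<forall>e \<in> X \<rightarrow>\<^sub>E T M Y. compose X (kleisli M X Y e) (eta M X) = e) \<and>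
    (\<forall>X\<in>Obj M. \<forall>Y\<in>Obj M. \<forall>Z\<in>Obj M. \<forall>e \<in> X \<rightarrow>\<^sub>E T M Y. \<forall>g \<in> Y \<rightarrow>\<^sub>E T M Z.
       kleisli M X Z (compose X (kleisli M Y Z g) e) =
       compose (T M X) (kleisli M Y Z g) (kleisli M X Y e))"

definition T_map :: "'u kleisli_triple \<Rightarrow> 'u set \<Rightarrow> 'u set \<Rightarrow> ('u \<Rightarrow> 'u) \<Rightarrow> 'u \<Rightarrow> 'u" where
  "T_map M X Y f = kleisli M X Y (compose X (eta M Y) f)"

definition T_mult :: "'u kleisli_triple \<Rightarrow> 'u set \<Rightarrow> 'u \<Rightarrow> 'u" where
  "T_mult M X = kleisli M (T M X) X (\<lambda>u\<in>T M X. u)"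

definition T_algebra :: "'u kleisli_triple \<Rightarrow> 'u set \<Rightarrow> ('u \<Rightarrow> 'u) \<Rightarrow> bool" where
  "T_algebra M R \<alpha> \<longleftrightarrow>
    R \<in> Obj M \<and> \<alpha> \<in> T M R \<rightarrow>\<^sub>E R \<and>
    compose R \<alpha> (eta M R) = (\<lambda>r\<in>R. r) \<and>
    compose (T M (T M R)) \<alpha> (T_map M (T M R) R \<alpha>) =
    compose (T M (T M R)) \<alpha> (T_mult M R)"

definition tuples :: "nat \<Rightarrow> 'a set \<Rightarrow> 'a list set" where
  "tuples n A = {xs. length xs = n \<and> set xs \<subseteq> A}"

definition algebraic_op ::
    "'u kleisli_triple \<Rightarrow> nat \<Rightarrow> ('u set \<Rightarrow> 'u list \<Rightarrow> 'u) \<Rightarrow> bool" where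
  "algebraic_op M n opr \<longleftrightarrow>
    (\<forall>X\<in>Obj M. opr X \<in> tuples n (T M X) \<rightarrow> T M X) \<and>
    (\<forall>X\<in>Obj M. \<forall>Y\<in>Obj M. \<forall>e \<in> X \<rightarrow>\<^sub>E T M Y. \<forall>us \<in> tuples n (T M X).
       kleisli M X Y e (opr X us) = opr Y (map (kleisli M X Y e) us))"

definition induced_op ::
    "'u kleisli_triple \<Rightarrow> 'u set \<Rightarrow> ('u \<Rightarrow> 'u) \<Rightarrow> ('u set \<Rightarrow> 'u list \<Rightarrow> 'u) \<Rightarrow> 'u list \<Rightarrow> 'u" where
  "induced_op M R \<alpha> opr rs = \<alpha> (opr R (map (eta M R) rs))"

definition Sel :: "'u kleisli_triple \<Rightarrow> 'u set \<Rightarrow> 'u set \<Rightarrow> (('u \<Rightarrow> 'u) \<Rightarrow> 'u) set" where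
  "Sel M R X = (X \<rightarrow>\<^sub>E R) \<rightarrow>\<^sub>E T M X"

text \<open>The value \<open>\<^bold>R(F|\<gamma>)\<close> for \<open>F \<in> Sel M R X\<close>.\<close>

definition reward ::
    "'u kleisli_triple \<Rightarrow> 'u set \<Rightarrow> ('u \<Rightarrow> 'u) \<Rightarrow> 'u set \<Rightarrow> (('u \<Rightarrow> 'u) \<Rightarrow> 'u) \<Rightarrow> ('u \<Rightarrow> 'u) \<Rightarrow> 'u" where
  "reward M R \<alpha> X F \<gamma> = \<alpha> (T_map M X R \<gamma> (F \<gamma>))"

definition pointwise_op ::
    "'u set \<Rightarrow> ('u set \<Rightarrow> 'u list \<Rightarrow> 'u) \<Rightarrow> 'u set \<Rightarrow> (('u \<Rightarrow> 'u) \<Rightarrow> 'u) list \<Rightarrow> ('u \<Rightarrow> 'u) \<Rightarrow> 'u" where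
  "pointwise_op R opr X Fs = (\<lambda>\<gamma> \<in> X \<rightarrow>\<^sub>E R. opr X (map (\<lambda>F. F \<gamma>) Fs))"

definition rel_op ::
    "'u kleisli_triple \<Rightarrow> 'u set \<Rightarrow> ('u \<Rightarrow> 'u) \<Rightarrow> 'u rel \<Rightarrow> 'u set \<Rightarrow>
      (('u \<Rightarrow> 'u) \<Rightarrow> 'u) \<Rightarrow> (('u \<Rightarrow> 'u) \<Rightarrow> 'u) \<Rightarrow> ('u \<Rightarrow> 'u) \<Rightarrow> 'u" where
  "rel_op M R \<alpha> B X G\<^sub>0 G\<^sub>1 =
    (\<lambda>\<gamma> \<in> X \<rightarrow>\<^sub>E R. if (reward M R \<alpha> X G\<^sub>0 \<gamma>, reward M R \<alpha> X G\<^sub>1 \<gamma>) \<in> B then G\<^sub>0 \<gamma> else G\<^sub>1 \<gamma>)"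

text \<open>
  In the next two definitions the \<open>i\<close>-th entry of the quantified tuple is overwritten and
  hence irrelevant; that it is required to exist is harmless, as \<open>s\<^sub>0\<close> (resp.
  \<open>G\<^sub>0\<close>) can serve.
\<close>

definition distributes_over_rel :: "nat \<Rightarrow> 'u set \<Rightarrow> ('u list \<Rightarrow> 'u) \<Rightarrow> 'u rel \<Rightarrow> bool" where
  "distributes_over_rel n R f B \<longleftrightarrow>
    (\<forall>i<n. \<forall>rs \<in> tuples n R. \<forall>s\<^sub>0\<in>R. \<forall>s\<^sub>1\<in>R.
       (s\<^sub>0, s\<^sub>1) \<in> B \<longleftrightarrow> (f (rs[i := s\<^sub>0]), f (rs[i := s\<^sub>1])) \<in> B)"

definition distributes_over_rel_op ::
    "'u kleisli_triple \<Rightarrow> 'u set \<Rightarrow> ('u \<Rightarrow> 'u) \<Rightarrow> nat \<Rightarrow> ('u set \<Rightarrow> 'u list \<Rightarrow> 'u) \<Rightarrow> 'u rel \<Rightarrow> bool" where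
  "distributes_over_rel_op M R \<alpha> n opr B \<longleftrightarrow>
    (\<forall>X\<in>Obj M. \<forall>i<n. \<forall>Fs \<in> tuples n (Sel M R X). \<forall>G\<^sub>0\<in>Sel M R X. \<forall>G\<^sub>1\<in>Sel M R X.
       pointwise_op R opr X (Fs[i := rel_op M R \<alpha> B X G\<^sub>0 G\<^sub>1]) =
       rel_op M R \<alpha> B X (pointwise_op R opr X (Fs[i := G\<^sub>0])) (pointwise_op R opr X (Fs[i := G\<^sub>1])))"

end

theory Submission imports Defs begin

text \<open>
  Applying \<open>\<alpha>\<close> turns an algebraic operation on \<open>T R\<close> into the induced operation on \<open>R\<close>: both
  arise from the element \<open>op (\<eta> v\<^sub>0, \<dots>, \<eta> v\<^sub>k)\<close> of \<open>T (T R)\<close>, the one along the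
  multiplication and the other along \<open>T \<alpha>\<close>, and \<open>\<alpha>\<close> equalizes these two maps.  Since \<open>T \<gamma>\<close>
  commutes with the operation too, the reward of a pointwise operation is the induced operation
  on the rewards, so that the two sides of the claim always select the same branch.
\<close>

lemma tuples_map: "xs \<in> tuples n A \<Longrightarrow> f \<in> A \<rightarrow> B \<Longrightarrow> map f xs \<in> tuples n B"
  by (auto simp: tuples_def)

lemma tuples_update: "xs \<in> tuples n A \<Longrightarrow> x \<in> A \<Longrightarrow> xs[i := x] \<in> tuples n A"
  using set_update_subset_insert[of xs i x] by (auto simp: tuples_def)

lemma tuples_map_cong:
  "xs \<in> tuples n A \<Longrightarrow> (\<And>x. x \<in> A \<Longrightarrow> f x = g x) \<Longrightarrow> map f xs = map g xs"
  by (auto simp: tuples_def)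

lemma algebra_Obj: "T_algebra M R \<alpha> \<Longrightarrow> R \<in> Obj M"
  and algebra_funcset: "T_algebra M R \<alpha> \<Longrightarrow> \<alpha> \<in> T M R \<rightarrow>\<^sub>E R"
  by (simp_all add: T_algebra_def)

lemma algebra_mult:
  assumes "T_algebra M R \<alpha>" "w \<in> T M (T M R)"
  shows "\<alpha> (T_map M (T M R) R \<alpha> w) = \<alpha> (T_mult M R w)"
proof -
  have "compose (T M (T M R)) \<alpha> (T_map M (T M R) R \<alpha>) =
      compose (T M (T M R)) \<alpha> (T_mult M R)"
    using assms(1) by (simp add: T_algebra_def)
  from fun_cong[OF this, of w] show ?thesis
    using assms(2) by (simp add: compose_eq)
qed

context
  fixes M :: "'u kleisli_triple"
  assumes monad: "set_monad M"
begin

lemma T_Obj: "X \<in> Obj M \<Longrightarrow> T M X \<in> Obj M"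
  using monad by (simp add: set_monad_def)

lemma eta_funcset: "X \<in> Obj M \<Longrightarrow> eta M X \<in> X \<rightarrow>\<^sub>E T M X"
  using monad by (simp add: set_monad_def)

lemma kleisli_funcset:
  "X \<in> Obj M \<Longrightarrow> Y \<in> Obj M \<Longrightarrow> e \<in> X \<rightarrow>\<^sub>E T M Y \<Longrightarrow> kleisli M X Y e \<in> T M X \<rightarrow>\<^sub>E T M Y"
  using monad by (simp add: set_monad_def)

lemma kleisli_eta:
  assumes "X \<in> Obj M" "Y \<in> Obj M" "e \<in> X \<rightarrow>\<^sub>E T M Y" "x \<in> X"
  shows "kleisli M X Y e (eta M X x) = e x"
proof -
  have "compose X (kleisli M X Y e) (eta M X) = e"
    using monad assms unfolding set_monad_def by blast
  then show ?thesis
    using compose_eq[OF \<open>x \<in> X\<close>, of "kleisli M X Y e" "eta M X"] by simp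
qed

lemma compose_eta_funcset:
  assumes "Y \<in> Obj M" "f \<in> X \<rightarrow>\<^sub>E Y"
  shows "compose X (eta M Y) f \<in> X \<rightarrow>\<^sub>E T M Y"
  using eta_funcset[of Y] assms by (auto simp: compose_def)

lemma T_map_funcset:
  "X \<in> Obj M \<Longrightarrow> Y \<in> Obj M \<Longrightarrow> f \<in> X \<rightarrow>\<^sub>E Y \<Longrightarrow> T_map M X Y f \<in> T M X \<rightarrow>\<^sub>E T M Y"
  unfolding T_map_def by (intro kleisli_funcset compose_eta_funcset)

text \<open>Naturality of the unit: \<open>T_map\<close> is the extension of \<open>eta\<close>
  after \<open>f\<close>, so this is an instance of the unit law \<open>kleisli_eta\<close>.\<close>

lemma T_map_eta:
  "X \<in> Obj M \<Longrightarrow> Y \<in> Obj M \<Longrightarrow> f \<in> X \<rightarrow>\<^sub>E Y \<Longrightarrow> x \<in> X \<Longrightarrow>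
    T_map M X Y f (eta M X x) = eta M Y (f x)"
  by (simp add: T_map_def kleisli_eta compose_eta_funcset compose_eq)

lemma T_mult_eta: "X \<in> Obj M \<Longrightarrow> u \<in> T M X \<Longrightarrow> T_mult M X (eta M (T M X) u) = u"
  by (simp add: T_mult_def kleisli_eta T_Obj)

text \<open>Distributivity over \<open>B\<close> is assumed only for arguments in \<open>R\<close>;
  this places the rewards there.\<close>

lemma reward_closed:
  assumes algebra: "T_algebra M R \<alpha>" and "X \<in> Obj M" "F \<in> Sel M R X" "\<gamma> \<in> X \<rightarrow>\<^sub>E R"
  shows "reward M R \<alpha> X F \<gamma> \<in> R"
proof -
  have "F \<gamma> \<in> T M X"
    using assms by (auto simp: Sel_def)
  then have "T_map M X R \<gamma> (F \<gamma>) \<in> T M R"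
    using T_map_funcset[OF _ algebra_Obj[OF algebra]] assms by blast
  then show ?thesis
    unfolding reward_def using algebra_funcset[OF algebra] by blast
qed

context
  fixes n :: nat and opr :: "'u set \<Rightarrow> 'u list \<Rightarrow> 'u"
  assumes alg_op: "algebraic_op M n opr"
begin

lemma opr_closed: "X \<in> Obj M \<Longrightarrow> us \<in> tuples n (T M X) \<Longrightarrow> opr X us \<in> T M X"
  using alg_op by (auto simp: algebraic_op_def)

lemma kleisli_opr:
  "X \<in> Obj M \<Longrightarrow> Y \<in> Obj M \<Longrightarrow> e \<in> X \<rightarrow>\<^sub>E T M Y \<Longrightarrow> us \<in> tuples n (T M X) \<Longrightarrow>
    kleisli M X Y e (opr X us) = opr Y (map (kleisli M X Y e) us)"
  using alg_op by (simp add: algebraic_op_def)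

lemma T_map_opr:
  "X \<in> Obj M \<Longrightarrow> Y \<in> Obj M \<Longrightarrow> f \<in> X \<rightarrow>\<^sub>E Y \<Longrightarrow> us \<in> tuples n (T M X) \<Longrightarrow>
    T_map M X Y f (opr X us) = opr Y (map (T_map M X Y f) us)"
  by (simp add: T_map_def kleisli_opr compose_eta_funcset)

text \<open>The multiplication is the Kleisli extension of the identity of \<open>T M X\<close>,
  read as a morphism into \<open>T M X\<close>, so algebraicity covers it as well.\<close>

lemma T_mult_opr:
  "X \<in> Obj M \<Longrightarrow> ws \<in> tuples n (T M (T M X)) \<Longrightarrow>
    T_mult M X (opr (T M X) ws) = opr X (map (T_mult M X) ws)"
  by (simp add: T_mult_def kleisli_opr T_Obj)

lemma algebra_opr:
  assumes algebra: "T_algebra M R \<alpha>" and vs: "vs \<in> tuples n (T M R)"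
  shows "\<alpha> (opr R vs) = induced_op M R \<alpha> opr (map \<alpha> vs)"
proof -
  note R = algebra_Obj[OF algebra]
  note TR = T_Obj[OF R] and \<alpha> = algebra_funcset[OF algebra]
  define ws where "ws = map (eta M (T M R)) vs"
  have ws: "ws \<in> tuples n (T M (T M R))"
    unfolding ws_def using eta_funcset[OF TR] by (intro tuples_map[OF vs]) auto
  \<comment> \<open>Multiplication undoes the outer unit. Writing \<open>vs\<close> as
    \<open>map id vs\<close> lets the two lists be compared entrywise by
    \<open>tuples_map_cong\<close>.\<close>
  have "map (T_mult M R) ws = map id vs"
    unfolding ws_def map_map using R by (intro tuples_map_cong[OF vs]) (simp add: T_mult_eta)
  then have mult: "T_mult M R (opr (T M R) ws) = opr R vs"
    using T_mult_opr[OF R ws] by simp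
  \<comment> \<open>Naturality of the unit along \<alpha> produces exactly the list on which
    \<open>induced_op\<close> evaluates the operation.\<close>
  have "map (T_map M (T M R) R \<alpha>) ws = map (eta M R) (map \<alpha> vs)"
    unfolding ws_def map_map using R TR \<alpha>
    by (intro tuples_map_cong[OF vs]) (simp add: T_map_eta)
  then have "T_map M (T M R) R \<alpha> (opr (T M R) ws) = opr R (map (eta M R) (map \<alpha> vs))"
    using T_map_opr[OF TR R \<alpha> ws] by simp
  with mult algebra_mult[OF algebra opr_closed[OF TR ws]] show ?thesis
    by (simp add: induced_op_def)
qed

lemma reward_pointwise_op:
  assumes algebra: "T_algebra M R \<alpha>" and X: "X \<in> Obj M"
    and Fs: "Fs \<in> tuples n (Sel M R X)" and \<gamma>: "\<gamma> \<in> X \<rightarrow>\<^sub>E R"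
  shows "reward M R \<alpha> X (pointwise_op R opr X Fs) \<gamma> =
    induced_op M R \<alpha> opr (map (\<lambda>F. reward M R \<alpha> X F \<gamma>) Fs)"
proof -
  note R = algebra_Obj[OF algebra]
  define us where "us = map (\<lambda>F. F \<gamma>) Fs"
  have us: "us \<in> tuples n (T M X)"
    unfolding us_def using \<gamma> by (intro tuples_map[OF Fs]) (auto simp: Sel_def)
  have "map (T_map M X R \<gamma>) us \<in> tuples n (T M R)"
    using T_map_funcset[OF X R \<gamma>] by (intro tuples_map[OF us]) auto
  \<comment> \<open>First \<open>T_map\<close> along \<gamma> moves inside the operation, then
    \<open>algebra_opr\<close> brings \<alpha> inside.\<close>
  then have "\<alpha> (T_map M X R \<gamma> (opr X us)) =
      induced_op M R \<alpha> opr (map \<alpha> (map (T_map M X R \<gamma>) us))"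
    by (simp only: T_map_opr[OF X R \<gamma> us] algebra_opr[OF algebra])
  then show ?thesis
    using \<gamma> by (simp add: reward_def pointwise_op_def us_def comp_def)
qed

end

end

theorem theorem2p7:
  fixes M :: "'u kleisli_triple" and R :: "'u set" and \<alpha> :: "'u \<Rightarrow> 'u"
    and n :: nat and opr :: "'u set \<Rightarrow> 'u list \<Rightarrow> 'u" and B :: "'u rel"
  assumes "set_monad M"
    and "T_algebra M R \<alpha>"
    and "algebraic_op M n opr"
    and "B \<subseteq> R \<times> R"
    and "distributes_over_rel n R (induced_op M R \<alpha> opr) B"
  shows "distributes_over_rel_op M R \<alpha> n opr B"
  unfolding distributes_over_rel_op_def
proof (intro ballI allI impI)
  fix X i Fs G\<^sub>0 G\<^sub>1
  assume X: "X \<in> Obj M" and i: "i < n" and Fs: "Fs \<in> tuples n (Sel M R X)"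
    and G\<^sub>0: "G\<^sub>0 \<in> Sel M R X" and G\<^sub>1: "G\<^sub>1 \<in> Sel M R X"
  let ?rew = "reward M R \<alpha> X" and ?P = "\<lambda>G. pointwise_op R opr X (Fs[i := G])"
  note closed = reward_closed[OF assms(1,2) X]
  have same_branch: "(?rew G\<^sub>0 \<gamma>, ?rew G\<^sub>1 \<gamma>) \<in> B \<longleftrightarrow> (?rew (?P G\<^sub>0) \<gamma>, ?rew (?P G\<^sub>1) \<gamma>) \<in> B"
    if \<gamma>: "\<gamma> \<in> X \<rightarrow>\<^sub>E R" for \<gamma>
  proof -
    define rs where "rs = map (\<lambda>F. ?rew F \<gamma>) Fs"
    have rs: "rs \<in> tuples n R"
      unfolding rs_def using closed \<gamma> by (intro tuples_map[OF Fs]) auto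
    \<comment> \<open>Taking rewards entrywise commutes with overwriting entry \<open>i\<close>. For
      \<open>G\<^sub>0\<close> and \<open>G\<^sub>1\<close> this gives the two sides of the
      distributivity hypothesis, with the rewards of \<open>G\<^sub>0\<close> and
      \<open>G\<^sub>1\<close> as the varying arguments.\<close>
    have "?rew (?P G) \<gamma> = induced_op M R \<alpha> opr (rs[i := ?rew G \<gamma>])" if "G \<in> Sel M R X" for G
      using reward_pointwise_op[OF assms(1,3,2) X tuples_update[OF Fs that] \<gamma>]
      by (simp add: rs_def map_update)
    then show ?thesis
      using assms(5) i rs closed G\<^sub>0 G\<^sub>1 \<gamma> by (simp add: distributes_over_rel_def)
  qed
  show "?P (rel_op M R \<alpha> B X G\<^sub>0 G\<^sub>1) = rel_op M R \<alpha> B X (?P G\<^sub>0) (?P G\<^sub>1)"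
  proof
    fix \<gamma>
    show "?P (rel_op M R \<alpha> B X G\<^sub>0 G\<^sub>1) \<gamma> = rel_op M R \<alpha> B X (?P G\<^sub>0) (?P G\<^sub>1) \<gamma>"
    proof (cases "\<gamma> \<in> X \<rightarrow>\<^sub>E R")
      case True
      then show ?thesis
        \<comment> \<open>On the left, entry \<open>i\<close> evaluated at \<gamma> is the branch
          chosen by the rewards of \<open>G\<^sub>0\<close> and \<open>G\<^sub>1\<close>; on the
          right, the rewards of the combined functions choose. By \<open>same_branch\<close> the
          choices agree, and in each case both sides apply \<open>opr X\<close> to the same
          list.\<close>
        using same_branch[OF True]
        by (simp add: rel_op_def pointwise_op_def[of R opr X "Fs[i := _]"] map_update)
    next
      case False
      \<comment> \<open>Outside the domain both restricted functions take the value
        \<open>undefined\<close>.\<close>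
      then show ?thesis
        by (simp add: rel_op_def pointwise_op_def)
    qed
  qed
qed

end
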